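(* Let $G$ be a graph. For every edge $e\in E(G)$, the equivalence class of $e$ under $\mathcal{C}_G$ is equal to $S_e$.
   Context: A quasi-transitive $2$-edge-colouring of a graph $G$ is a map $c: E(G)\to\{R,B\}$ such that for all pairs of edges $xy, yz \in E(G)$ with $c(xy)\neq c(yz)$, we have $xz\in E(G)$. $\mathcal{C}_G$ is the equivalence relation on $E(G)$ with $e\sim f$ iff $c(e)=c(f)$ for every quasi-transitive $2$-edge-colouring $c$ of $G$. For $e\in E(G)$, let $\mathcal{S}_e$ be the family of all sets $S\subseteq E(G)$ such that $e\in S$ and, for every edge $d\notin S$, there is no induced copy of $P_3$ in $G$ consisting of $d$ and an edge of $S$. $S_e$ denotes the member of $\mathcal{S}_e$ of minimum cardinality (it is unique; equivalently it is the intersection of all members of $\mathcal{S}_e$). *)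

theory Defs
  imports "HOL-Library.Ramsey"
begin

text \<open>
  A finite simple graph is given by its vertex set \<open>V\<close> and its edge set \<open>E\<close>, the edges being
  two-element sets of vertices.
\<close>

definition simple_graph :: "'a set \<Rightarrow> 'a set set \<Rightarrow> bool" where
  "simple_graph V E \<longleftrightarrow> finite V \<and> E \<subseteq> nsets V 2"

datatype colour = Red | Blue

text \<open>
  Only the values of a colouring on \<open>E\<close> matter. If \<open>x = z\<close>, the two edges coincide and the
  premise on colours is false.
\<close>

definition quasi_transitive :: "'a set set \<Rightarrow> ('a set \<Rightarrow> colour) \<Rightarrow> bool" where
  "quasi_transitive E c \<longleftrightarrow>
     (\<forall>x y z. {x, y} \<in> E \<longrightarrow> {y, z} \<in> E \<longrightarrow> c {x, y} \<noteq> c {y, z} \<longrightarrow> {x, z} \<in> E)"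

definition colour_equiv :: "'a set set \<Rightarrow> 'a set rel" where
  "colour_equiv E =
     {(e, f). e \<in> E \<and> f \<in> E \<and> (\<forall>c. quasi_transitive E c \<longrightarrow> c e = c f)}"

text \<open>Here \<open>P\<^sub>3\<close> is the path on three vertices.\<close>

definition induced_P3 :: "'a set set \<Rightarrow> 'a set \<Rightarrow> 'a set \<Rightarrow> bool" where
  "induced_P3 E d f \<longleftrightarrow>
     (\<exists>x y z. distinct [x, y, z] \<and> d = {x, y} \<and> f = {y, z} \<and>
        {x, y} \<in> E \<and> {y, z} \<in> E \<and> {x, z} \<notin> E)"

definition P3_family :: "'a set set \<Rightarrow> 'a set \<Rightarrow> 'a set set set" where
  "P3_family E e =
     {S. S \<subseteq> E \<and> e \<in> S \<and> (\<forall>d\<in>E - S. \<not> (\<exists>f\<in>S. induced_P3 E d f))}"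

definition P3_min :: "'a set set \<Rightarrow> 'a set \<Rightarrow> 'a set set" where
  "P3_min E e = (THE S. S \<in> P3_family E e \<and> (\<forall>T\<in>P3_family E e. card S \<le> card T))"

lemma simple_graph_finite_edges: "simple_graph V E \<Longrightarrow> finite E"
  unfolding simple_graph_def by (meson finite_imp_finite_nsets finite_subset)

lemma equiv_colour_equiv: "equiv E (colour_equiv E)"
  by (rule equivI) (auto simp: colour_equiv_def refl_on_def sym_def trans_def)

lemma Inter_in_P3_family:
  assumes "e \<in> E"
  shows "\<Inter> (P3_family E e) \<in> P3_family E e"
proof -
  have "E \<in> P3_family E e"
    using assms by (simp add: P3_family_def)
  then show ?thesis
    unfolding P3_family_def by blast
qed

lemma P3_min_unique:
  assumes "finite E" "e \<in> E"
  shows "\<exists>!S. S \<in> P3_family E e \<and> (\<forall>T\<in>P3_family E e. card S \<le> card T)"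
    and "P3_min E e = \<Inter> (P3_family E e)"
proof -
  let ?I = "\<Inter> (P3_family E e)"
  have fin: "finite T" if "T \<in> P3_family E e" for T
    using that assms(1) by (auto simp: P3_family_def intro: finite_subset)
  have I: "?I \<in> P3_family E e"
    using assms(2) by (rule Inter_in_P3_family)
  have min: "?I \<in> P3_family E e \<and> (\<forall>T\<in>P3_family E e. card ?I \<le> card T)"
    using I fin by (auto intro!: card_mono)
  have uniq: "S = ?I"
    if "S \<in> P3_family E e \<and> (\<forall>T\<in>P3_family E e. card S \<le> card T)" for S
    using that I fin card_seteq[of S ?I] by blast
  show "\<exists>!S. S \<in> P3_family E e \<and> (\<forall>T\<in>P3_family E e. card S \<le> card T)"
    using min uniq by blast
  show "P3_min E e = ?I"
    unfolding P3_min_def using min uniq by (rule the_equality)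
qed

end

theory Submission
  imports Defs
begin

text \<open>
  A colouring is quasi-transitive iff the two edges of every induced \<open>P\<^sub>3\<close> receive the same
  colour. Hence the class of \<open>e\<close> belongs to \<open>\<S>\<^sub>e\<close>. Conversely, for any member \<open>S\<close> of
  \<open>\<S>\<^sub>e\<close>, colouring \<open>S\<close> red and all other edges blue is quasi-transitive, so no edge
  outside \<open>S\<close> is equivalent to \<open>e\<close>.
\<close>

lemma induced_P3_in_edges:
  assumes "induced_P3 E d f"
  shows "d \<in> E" and "f \<in> E"
  using assms by (auto simp: induced_P3_def)

lemma induced_P3_sym:
  assumes "induced_P3 E d f"
  shows "induced_P3 E f d"
proof -
  obtain x y z where "distinct [x, y, z]" "d = {x, y}" "f = {y, z}"
    and "{x, y} \<in> E" "{y, z} \<in> E" "{x, z} \<notin> E"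
    using assms unfolding induced_P3_def by blast
  then have "distinct [z, y, x]" "f = {z, y}" "d = {y, x}"
    and "{z, y} \<in> E" "{y, x} \<in> E" "{z, x} \<notin> E"
    by (auto simp: insert_commute)
  then show ?thesis
    unfolding induced_P3_def by blast
qed

lemma quasi_transitive_iff_induced_P3:
  "quasi_transitive E c \<longleftrightarrow> (\<forall>d f. induced_P3 E d f \<longrightarrow> c d = c f)"
proof
  assume "quasi_transitive E c"
  then show "\<forall>d f. induced_P3 E d f \<longrightarrow> c d = c f"
    unfolding quasi_transitive_def induced_P3_def by blast
next
  assume same_colour: "\<forall>d f. induced_P3 E d f \<longrightarrow> c d = c f"
  show "quasi_transitive E c"
    unfolding quasi_transitive_def
  proof (intro allI impI, rule ccontr)
    fix x y z
    assume edges: "{x, y} \<in> E" "{y, z} \<in> E"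
      and colours: "c {x, y} \<noteq> c {y, z}"
      and non_edge: "{x, z} \<notin> E"
    have "x \<noteq> y" and "y \<noteq> z"
      using edges non_edge by auto
    moreover have "x \<noteq> z"
      using colours by (auto simp: insert_commute)
    ultimately have "induced_P3 E {x, y} {y, z}"
      using edges non_edge unfolding induced_P3_def by auto
    then show False
      using same_colour colours by blast
  qed
qed

definition red_on :: "'a set set \<Rightarrow> 'a set \<Rightarrow> colour" where
  "red_on S f = (if f \<in> S then Red else Blue)"

lemma red_on_eq_iff: "red_on S d = red_on S f \<longleftrightarrow> (d \<in> S \<longleftrightarrow> f \<in> S)"
  by (simp add: red_on_def)

lemma P3_family_iff_quasi_transitive_red_on:
  "S \<in> P3_family E e \<longleftrightarrow> S \<subseteq> E \<and> e \<in> S \<and> quasi_transitive E (red_on S)"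
proof -
  have "(\<forall>d\<in>E - S. \<not> (\<exists>f\<in>S. induced_P3 E d f)) \<longleftrightarrow>
      (\<forall>d f. induced_P3 E d f \<longrightarrow> (d \<in> S \<longleftrightarrow> f \<in> S))"
    using induced_P3_in_edges[of E] induced_P3_sym[of E] by (metis DiffD2 DiffI)
  then show ?thesis
    by (simp add: P3_family_def quasi_transitive_iff_induced_P3 red_on_eq_iff)
qed

lemma induced_P3_imp_colour_equiv:
  assumes "induced_P3 E d f"
  shows "(d, f) \<in> colour_equiv E"
  using assms induced_P3_in_edges[OF assms]
  by (auto simp: colour_equiv_def quasi_transitive_iff_induced_P3)

lemma colour_class_in_P3_family:
  assumes "e \<in> E"
  shows "colour_equiv E `` {e} \<in> P3_family E e"
proof -
  have "d \<in> colour_equiv E `` {e}"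
    if "f \<in> colour_equiv E `` {e}" and "induced_P3 E d f" for d f
  proof -
    have "trans (colour_equiv E)"
      using equiv_colour_equiv by (rule equivE)
    moreover have "(e, f) \<in> colour_equiv E"
      using that(1) by simp
    moreover have "(f, d) \<in> colour_equiv E"
      using induced_P3_imp_colour_equiv[OF induced_P3_sym[OF that(2)]] .
    ultimately have "(e, d) \<in> colour_equiv E"
      by (rule transD)
    then show ?thesis by simp
  qed
  moreover have "colour_equiv E `` {e} \<subseteq> E"
    by (auto simp: colour_equiv_def)
  moreover have "e \<in> colour_equiv E `` {e}"
    using equiv_colour_equiv assms by (rule equiv_class_self)
  ultimately show ?thesis
    unfolding P3_family_def by blast
qed

lemma colour_class_subset_P3_family:
  assumes "S \<in> P3_family E e"
  shows "colour_equiv E `` {e} \<subseteq> S"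
proof
  fix f assume "f \<in> colour_equiv E `` {e}"
  moreover have "quasi_transitive E (red_on S)" and "e \<in> S"
    using assms by (simp_all add: P3_family_iff_quasi_transitive_red_on)
  ultimately have "red_on S e = red_on S f"
    by (simp add: colour_equiv_def)
  with \<open>e \<in> S\<close> show "f \<in> S"
    by (simp add: red_on_eq_iff)
qed

lemma colour_class_eq_Inter_P3_family:
  assumes "e \<in> E"
  shows "colour_equiv E `` {e} = \<Inter> (P3_family E e)"
proof
  show "colour_equiv E `` {e} \<subseteq> \<Inter> (P3_family E e)"
    by (intro Inter_greatest colour_class_subset_P3_family)
  show "\<Inter> (P3_family E e) \<subseteq> colour_equiv E `` {e}"
    using assms by (intro Inter_lower colour_class_in_P3_family)
qed

theorem theorem8:
  fixes V :: "'a set" and E :: "'a set set" and e :: "'a set"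
  assumes "simple_graph V E" and "e \<in> E"
  shows "colour_equiv E `` {e} = P3_min E e"
proof -
  have "finite E"
    using assms(1) by (rule simple_graph_finite_edges)
  have "colour_equiv E `` {e} = \<Inter> (P3_family E e)"
    using assms(2) by (rule colour_class_eq_Inter_P3_family)
  also have "\<dots> = P3_min E e"
    using P3_min_unique(2)[OF \<open>finite E\<close> assms(2)] by (rule sym)
  finally show ?thesis .
qed

end
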